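(* Let $G$ be a divisible abelian group, written additively, and write \[ G\cong\mathbb{Q}^{(\kappa_0)}\oplus\bigoplus_{p}C_{p^\infty}^{(\kappa_p)}, \] where $p$ ranges over the primes and $\kappa_0,\kappa_p$ are cardinals. Then $G$ admits an inverse ambiguous automorphism if and only if none of the cardinals \[ \kappa_0,\qquad \kappa_2,\qquad \kappa_p\quad (p \text{ prime},\ p\equiv 3\pmod 4) \] is a finite odd cardinal. (There is no restriction on $\kappa_p$ for primes $p\equiv 1\pmod 4$.)
   Context: A bijection $f$ of a group $G$ onto itself is called inverse ambiguous if $f^{-1}(x)=f(x)^{-1}$ for every $x\in G$, where $f^{-1}(x)$ is the preimage of $x$ under $f$ and $f(x)^{-1}$ is the group inverse of $f(x)$. An inverse ambiguous automorphism is a group automorphism that is inverse ambiguous; for an abelian group written additively, this means an automorphism $J$ with $J^{-1}(x)=-J(x)$ for all $x$. $C_{p^\infty}$ denotes the Prüfer $p$-group, and $H^{(\kappa)}$ denotes the direct sum of $\kappa$ copies of $H$. *)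

theory Defs
  imports
    Complex_Main
    "HOL-Computational_Algebra.Primes"
    "HOL-Algebra.Product_Groups"
begin

text \<open>Groups are those of HOL-Algebra, which writes every group multiplicatively: a sum
  \<open>x + y\<close> is \<open>x \<otimes> y\<close>, the negative \<open>- x\<close> is \<open>inv x\<close>, and \<open>n x\<close> is \<open>x [^] n\<close>.\<close>

definition divisible_group :: "('a, 'm) monoid_scheme \<Rightarrow> bool" where
  "divisible_group G \<longleftrightarrow>
     (\<forall>x\<in>carrier G. \<forall>n::nat. n > 0 \<longrightarrow> (\<exists>y\<in>carrier G. y [^]\<^bsub>G\<^esub> n = x))"

text \<open>Here \<open>f\<^sup>-\<^sup>1(x)\<close> is the preimage of \<open>x\<close> in the carrier; values of \<open>f\<close> outside the carrier
  are irrelevant.\<close>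

definition inverse_ambiguous :: "('a, 'm) monoid_scheme \<Rightarrow> ('a \<Rightarrow> 'a) \<Rightarrow> bool" where
  "inverse_ambiguous G f \<longleftrightarrow>
     bij_betw f (carrier G) (carrier G) \<and>
     (\<forall>x\<in>carrier G. inv_into (carrier G) f x = inv\<^bsub>G\<^esub> (f x))"

definition inverse_ambiguous_automorphism ::
    "('a, 'm) monoid_scheme \<Rightarrow> ('a \<Rightarrow> 'a) \<Rightarrow> bool" where
  "inverse_ambiguous_automorphism G f \<longleftrightarrow> f \<in> iso G G \<and> inverse_ambiguous G f"

definition rat_group :: "rat monoid" where
  "rat_group = \<lparr>carrier = UNIV, monoid.mult = (+), one = 0\<rparr>"

text \<open>The Pruefer group in its standard model, the complex roots of unity of \<open>p\<close>-power order.\<close>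

definition pruefer_group :: "nat \<Rightarrow> complex monoid" where
  "pruefer_group p =
     \<lparr>carrier = {z. \<exists>n::nat. z ^ (p ^ n) = 1}, monoid.mult = (*), one = 1\<rparr>"

text \<open>A cardinal is represented by an index set having that cardinality. The guard \<open>finite\<close>
  only makes the reading explicit: \<open>card\<close> of an infinite set is \<open>0\<close>.\<close>

definition finite_odd :: "'i set \<Rightarrow> bool" where
  "finite_odd I \<longleftrightarrow> finite I \<and> odd (card I)"

text \<open>\<open>direct_power I H\<close> is the direct sum of copies of \<open>H\<close> indexed by \<open>I\<close>; the library's
  \<open>sum_group\<close> consists of the families with finite support.\<close>

abbreviation direct_power :: "'i set \<Rightarrow> 'b monoid \<Rightarrow> ('i \<Rightarrow> 'b) monoid" where
  "direct_power I H \<equiv> sum_group I (\<lambda>_. H)"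

lemma comm_group_rat_group: "comm_group rat_group"
  unfolding rat_group_def
proof (rule comm_groupI; simp)
  show "\<exists>y::rat. y + x = 0" for x
    by (rule exI[of _ "- x"]) simp
qed

lemma comm_group_pruefer_group:
  assumes "p > 0"
  shows "comm_group (pruefer_group p)"
  unfolding pruefer_group_def
proof (rule comm_groupI; simp)
  fix x y :: complex
  assume "\<exists>n. x ^ p ^ n = 1" "\<exists>n. y ^ p ^ n = 1"
  then obtain m n where mn: "x ^ p ^ m = 1" "y ^ p ^ n = 1"
    by blast
  have "(x * y) ^ p ^ (m + n) = (x ^ p ^ m) ^ p ^ n * (y ^ p ^ n) ^ p ^ m"
    by (simp add: power_add power_mult_distrib mult.commute flip: power_mult)
  with mn show "\<exists>n. (x * y) ^ p ^ n = 1"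
    by auto
next
  fix x :: complex
  assume "\<exists>n. x ^ p ^ n = 1"
  then obtain n where n: "x ^ p ^ n = 1"
    by blast
  with assms have "x \<noteq> 0"
    by (auto simp: power_0_left split: if_splits)
  moreover have "inverse x ^ p ^ n = 1"
    using n by (simp add: power_inverse)
  ultimately show "\<exists>y. (\<exists>n. y ^ p ^ n = 1) \<and> y * x = 1"
    by (intro exI[of _ "inverse x"]) auto
qed

end

theory Submission
  imports Defs "HOL-Number_Theory.Euler_Criterion" "Jordan_Normal_Form.Determinant"
begin

text \<open>An inverse ambiguous automorphism is an endomorphism \<open>J\<close> with \<open>J\<^sup>2 = -1\<close>, that is, an
  action of the Gaussian integers.

  Existence: if \<open>I\<close> is infinite or of even cardinality, it splits into two halves in bijection, and
  \<open>(x, y) \<mapsto> (y, -x)\<close> works on every direct power with exponent \<open>I\<close>. For \<open>p \<equiv> 1 (mod 4)\<close>, multiplication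
  by a \<open>p\<close>-adic square root of \<open>-1\<close> works on a single copy of the Pruefer group.

  Obstructions: for \<open>p \<equiv> 3 (mod 4)\<close>, the orbits of \<open>J\<close> on the elements of order \<open>p\<close> have
  length \<open>4\<close>, so \<open>4\<close> divides \<open>p\<^sup>k - 1\<close> and \<open>k\<close> is even. The 2-torsion has the square cardinality
  \<open>|ker (1 + J)|\<^sup>2\<close>. On the quotient by the torsion, a rational vector space of dimension \<open>n\<close>,
  \<open>(det J)\<^sup>2 = (-1)\<^sup>n\<close>.\<close>

section \<open>Automorphisms squaring to inversion\<close>

text \<open>Bijectivity is implicit: \<open>inv (J x)\<close> defines a two-sided inverse of
  \<open>J\<close>. This form is convenient for constructing and combining automorphisms.\<close>

definition squares_to_inv :: "('a, 'm) monoid_scheme \<Rightarrow> ('a \<Rightarrow> 'a) \<Rightarrow> bool" where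
  "squares_to_inv G J \<longleftrightarrow> J \<in> hom G G \<and> (\<forall>x\<in>carrier G. J (J x) = inv\<^bsub>G\<^esub> x)"

lemma squares_to_invD:
  assumes "squares_to_inv G J" "x \<in> carrier G"
  shows "J x \<in> carrier G" "J (J x) = inv\<^bsub>G\<^esub> x"
  using assms by (auto simp: squares_to_inv_def hom_def)

lemma (in group) squares_to_inv_group_hom:
  "squares_to_inv G J \<Longrightarrow> group_hom G G J"
  by (simp add: squares_to_inv_def group_hom_def group_hom_axioms_def is_group)

text \<open>Applying the homomorphism \<open>J\<close> to the preimage \<open>inv (J x)\<close> of
  \<open>x\<close> gives \<open>x = inv (J (J x))\<close>. Read backwards, this identity exhibits
  the preimage and yields bijectivity.\<close>

lemma (in group) inverse_ambiguous_automorphism_iff: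
  "inverse_ambiguous_automorphism G J \<longleftrightarrow> squares_to_inv G J"
proof
  assume L: "inverse_ambiguous_automorphism G J"
  have J: "J \<in> hom G G" and bij: "bij_betw J (carrier G) (carrier G)"
    and inv: "\<And>x. x \<in> carrier G \<Longrightarrow> inv_into (carrier G) J x = inv (J x)"
    using L by (auto simp: inverse_ambiguous_automorphism_def inverse_ambiguous_def iso_def)
  interpret group_hom G G J
    using J by unfold_locales
  have "J (J x) = inv x" if x: "x \<in> carrier G" for x
  proof -
    have "J (inv (J x)) = x"
      using bij_betw_inv_into_right[OF bij x] inv[OF x] by simp
    then show ?thesis
      using x by (metis hom_inv hom_closed inv_inv)
  qed
  with J show "squares_to_inv G J"
    by (simp add: squares_to_inv_def)
next
  assume R: "squares_to_inv G J"
  interpret group_hom G G J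
    by (rule squares_to_inv_group_hom[OF R])
  have JJ: "J (J x) = inv x" if "x \<in> carrier G" for x
    using squares_to_invD(2)[OF R that] .
  have J_inv: "J (inv (J x)) = x" if "x \<in> carrier G" for x
    using that by (simp add: JJ)
  have bij: "bij_betw J (carrier G) (carrier G)"
    by (rule bij_betw_byWitness[where f' = "\<lambda>x. inv (J x)"]) (auto simp: J_inv JJ)
  have "inv_into (carrier G) J x = inv (J x)" if "x \<in> carrier G" for x
    using that J_inv by (intro inv_into_f_eq bij_betw_imp_inj_on[OF bij]) auto
  with bij show "inverse_ambiguous_automorphism G J"
    using homh
    by (simp add: inverse_ambiguous_automorphism_def inverse_ambiguous_def iso_def)
qed

text \<open>Conjugation by an isomorphism transports \<open>J\<close>.\<close>

lemma squares_to_inv_iso: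
  assumes "group G" "group H" "G \<cong> H" and ex: "\<exists>J. squares_to_inv G J"
  shows "\<exists>J. squares_to_inv H J"
proof -
  interpret G: group G by fact
  interpret H: group H by fact
  obtain J where J: "squares_to_inv G J"
    using ex by blast
  obtain f where f: "f \<in> iso G H"
    using assms(3) by (auto simp: is_iso_def)
  obtain g where g: "group_isomorphisms G H f g"
    using f G.iso_iff_group_isomorphisms by blast
  interpret f: group_hom G H f
    using g by unfold_locales (auto simp: group_isomorphisms_def)
  interpret g: group_hom H G g
    using g by unfold_locales (auto simp: group_isomorphisms_def)
  interpret J: group_hom G G J
    by (rule G.squares_to_inv_group_hom[OF J])
  have "(\<lambda>x. f (J (g x))) \<in> hom H H"
    by (auto simp: hom_def)
  moreover have "f (J (g (f (J (g x))))) = inv\<^bsub>H\<^esub> x" if "x \<in> carrier H" for x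
    using that g squares_to_invD(2)[OF J] by (simp add: group_isomorphisms_def)
  ultimately show ?thesis
    unfolding squares_to_inv_def by blast
qed

section \<open>Assembling automorphisms\<close>

lemma squares_to_inv_DirProd:
  assumes "group G" "group H" "squares_to_inv G J" "squares_to_inv H K"
  shows "squares_to_inv (G \<times>\<times> H) (\<lambda>(x, y). (J x, K y))"
  using assms by (auto simp: squares_to_inv_def hom_paired2)

lemma sum_groupI:
  assumes "\<And>i. i \<in> I \<Longrightarrow> group (G i)" "\<And>i. i \<in> I \<Longrightarrow> x i \<in> carrier (G i)"
    "finite {i \<in> I. x i \<noteq> \<one>\<^bsub>G i\<^esub>}"
  shows "(\<lambda>i\<in>I. x i) \<in> carrier (sum_group I G)"
proof -
  have "{i \<in> I. restrict x I i \<noteq> \<one>\<^bsub>G i\<^esub>} = {i \<in> I. x i \<noteq> \<one>\<^bsub>G i\<^esub>}"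
    by auto
  with assms show ?thesis
    by (simp add: carrier_sum_group)
qed

lemma sum_groupD:
  assumes "\<And>i. i \<in> I \<Longrightarrow> group (G i)" "x \<in> carrier (sum_group I G)"
  shows "i \<in> I \<Longrightarrow> x i \<in> carrier (G i)" "finite {i \<in> I. x i \<noteq> \<one>\<^bsub>G i\<^esub>}" "restrict x I = x"
  using assms by (auto simp: carrier_sum_group PiE_restrict)

lemma squares_to_inv_sum_group:
  assumes G: "\<And>i. i \<in> I \<Longrightarrow> group (G i)"
    and ex: "\<And>i. i \<in> I \<Longrightarrow> \<exists>J. squares_to_inv (G i) J"
  shows "\<exists>J. squares_to_inv (sum_group I G) J"
proof -
  obtain J where J: "\<And>i. i \<in> I \<Longrightarrow> squares_to_inv (G i) (J i)"
    using ex by metis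
  have hom: "group_hom (G i) (G i) (J i)" if "i \<in> I" for i
    using group.squares_to_inv_group_hom[OF G J] that by blast
  have mem: "x i \<in> carrier (G i)" if "x \<in> carrier (sum_group I G)" "i \<in> I" for x i
    using sum_groupD(1)[OF G that] by blast
  let ?J = "\<lambda>x. \<lambda>i\<in>I. J i (x i)"
  have closed: "?J x \<in> carrier (sum_group I G)" if x: "x \<in> carrier (sum_group I G)" for x
  proof (rule sum_groupI[OF G])
    \<comment> \<open>Each \<open>J i\<close> fixes the identity, so the support of a family cannot
      grow.\<close>
    show "finite {i \<in> I. J i (x i) \<noteq> \<one>\<^bsub>G i\<^esub>}"
      by (rule finite_subset[OF _ sum_groupD(2)[OF G x]]) (auto simp: group_hom.hom_one[OF hom])
  qed (use mem[OF x] squares_to_invD(1)[OF J] in auto)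
  have "?J \<in> hom (sum_group I G) (sum_group I G)"
  proof (rule homI)
    fix x y
    assume x: "x \<in> carrier (sum_group I G)" and y: "y \<in> carrier (sum_group I G)"
    show "?J (x \<otimes>\<^bsub>sum_group I G\<^esub> y) = ?J x \<otimes>\<^bsub>sum_group I G\<^esub> ?J y"
      using mem[OF x] mem[OF y] by (auto simp: group_hom.hom_mult[OF hom] intro!: restrict_ext)
  qed (rule closed)
  moreover have "?J (?J x) = inv\<^bsub>sum_group I G\<^esub> x" if x: "x \<in> carrier (sum_group I G)" for x
  proof -
    have "?J (?J x) = (\<lambda>i\<in>I. inv\<^bsub>G i\<^esub> x i)"
    proof (rule restrict_ext)
      fix i assume i: "i \<in> I"
      then show "J i (?J x i) = inv\<^bsub>G i\<^esub> x i"
        using squares_to_invD(2)[OF J[OF i] mem[OF x i]] by simp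
    qed
    also have "\<dots> = inv\<^bsub>sum_group I G\<^esub> x"
      using G x by (rule inv_sum_group[symmetric])
    finally show ?thesis .
  qed
  ultimately show ?thesis
    unfolding squares_to_inv_def by blast
qed

text \<open>A finite set of even size is cut at half its cardinality. An infinite set satisfies
  \<open>|I| + |I| = |I|\<close>, and the images of the two summands are the halves.\<close>

lemma not_finite_odd_halves:
  assumes "\<not> finite_odd I"
  obtains B h where "B \<subseteq> I" "bij_betw h B (I - B)"
proof (cases "finite I")
  case True
  then have ev: "even (card I)"
    using assms by (simp add: finite_odd_def)
  obtain B where B: "B \<subseteq> I" "card B = card I div 2"
    by (metis obtain_subset_with_card_n div_le_dividend)
  moreover have "card (I - B) = card B"
    using B ev True by (simp add: card_Diff_subset finite_subset) presburger
  ultimately show ?thesis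
    using that True by (metis finite_Diff finite_same_card_bij finite_subset)
next
  case False
  then obtain h where h: "bij_betw h (Sum_Type.Plus I I) I"
    using iffD2[OF card_of_ordIso card_of_Plus_infinite1[OF False card_of_mono1[OF subset_refl]]]
    by blast
  let ?B = "(h \<circ> Inl) ` I"
  have inj: "inj_on h (Sum_Type.Plus I I)" and img: "h ` (Sum_Type.Plus I I) = I"
    using h by (auto simp: bij_betw_def)
  have 1: "bij_betw (h \<circ> Inl) I ?B"
    by (rule inj_on_imp_bij_betw, rule comp_inj_on) (auto intro: inj_on_subset[OF inj])
  \<comment> \<open>As \<open>h\<close> is injective and onto \<open>I\<close>, the image of the
    right copy is exactly the complement of the image of the left copy.\<close>
  have "h ` (Inr ` I) = h ` (Sum_Type.Plus I I) - h ` (Inl ` I)"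
    by (subst inj_on_image_set_diff[OF inj, symmetric]) (auto simp: Plus_def intro!: arg_cong[where f = "image h"])
  then have "(h \<circ> Inr) ` I = I - ?B"
    by (simp add: img image_comp)
  then have 2: "bij_betw (h \<circ> Inr) I (I - ?B)"
    unfolding bij_betw_def
    by (intro conjI comp_inj_on) (auto intro: inj_on_subset[OF inj])
  have "?B \<subseteq> I"
    using img by auto
  with bij_betw_trans[OF bij_betw_inv_into[OF 1] 2] show ?thesis
    using that by blast
qed

text \<open>Commutativity of \<open>H\<close> makes inversion, and hence the signed swap of
  coordinates, a homomorphism.\<close>

lemma squares_to_inv_direct_power:
  assumes H: "comm_group H" and I: "\<not> finite_odd I"
  shows "\<exists>J. squares_to_inv (direct_power I H) J"
proof -
  interpret H: comm_group H by fact
  note gr = H.is_group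
  obtain B h where B: "B \<subseteq> I" and h: "bij_betw h B (I - B)"
    using not_finite_odd_halves[OF I] .
  \<comment> \<open>The involution of \<open>I\<close> that exchanges the two halves.\<close>
  define s where "s i = (if i \<in> B then h i else inv_into B h i)" for i
  have sI: "s i \<in> I" "s (s i) = i" "s i \<in> B \<longleftrightarrow> i \<notin> B" if "i \<in> I" for i
    using that B bij_betw_apply[OF h] bij_betw_apply[OF bij_betw_inv_into[OF h]]
      bij_betw_inv_into_left[OF h] bij_betw_inv_into_right[OF h]
    by (auto simp: s_def)
  \<comment> \<open>Exactly one of \<open>i\<close> and \<open>s i\<close> lies in \<open>B\<close>,
    so two applications of the map invert each coordinate exactly once.\<close>
  let ?J = "\<lambda>x. \<lambda>i\<in>I. if i \<in> B then x (s i) else inv\<^bsub>H\<^esub> x (s i)"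
  have mem: "x (s i) \<in> carrier H" if "x \<in> carrier (direct_power I H)" "i \<in> I" for x i
    using sum_groupD(1)[OF gr that(1)] sI(1)[OF that(2)] by blast
  have closed: "?J x \<in> carrier (direct_power I H)" if x: "x \<in> carrier (direct_power I H)" for x
  proof (rule sum_groupI[OF gr])
    have "{i \<in> I. (if i \<in> B then x (s i) else inv\<^bsub>H\<^esub> x (s i)) \<noteq> \<one>\<^bsub>H\<^esub>} \<subseteq> s ` {i \<in> I. x i \<noteq> \<one>\<^bsub>H\<^esub>}"
      using sI by (force simp: image_iff split: if_splits)
    then show "finite {i \<in> I. (if i \<in> B then x (s i) else inv\<^bsub>H\<^esub> x (s i)) \<noteq> \<one>\<^bsub>H\<^esub>}"
      using sum_groupD(2)[OF gr x] finite_surj by blast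
  qed (use mem[OF x] in auto)
  have "?J \<in> hom (direct_power I H) (direct_power I H)"
    using closed mem sI(1) by (auto simp: hom_def H.inv_mult intro!: restrict_ext)
  moreover have "?J (?J x) = inv\<^bsub>direct_power I H\<^esub> x" if x: "x \<in> carrier (direct_power I H)" for x
    using sI sum_groupD(1)[OF gr x] by (auto simp: inv_sum_group[OF gr x] intro!: restrict_ext)
  ultimately show ?thesis
    unfolding squares_to_inv_def by blast
qed

section \<open>The Pruefer group for \<open>p \<equiv> 1 (mod 4)\<close>\<close>

lemma exists_sqrt_minus_one_mod_prime:
  assumes p: "prime p" "p mod 4 = 1"
  obtains b :: nat where "[int b ^ 2 = - 1] (mod int p)"
proof -
  have "p \<noteq> 2" "p > 0"
    using p prime_gt_0_nat by auto
  then have "p > 2"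
    using prime_ge_2_nat[OF p(1)] by linarith
  have "even ((p - 1) div 2)"
    using p(2) by presburger
  then have "[Legendre (- 1) (int p) = 1] (mod int p)"
    using euler_criterion[OF p(1) \<open>p > 2\<close>, of "- 1"] by simp
  \<comment> \<open>These exclude the other two values of the Legendre symbol.\<close>
  moreover have "\<not> [0 = 1] (mod int p)" "\<not> [- 1 = 1] (mod int p)"
    using \<open>p > 2\<close> zdvd_imp_le[of "int p" 2] by (auto simp: cong_iff_dvd_diff)
  ultimately have "QuadRes (int p) (- 1)"
    by (auto simp: Legendre_def split: if_splits)
  then obtain y where y: "[y ^ 2 = - 1] (mod int p)"
    by (auto simp: QuadRes_def)
  \<comment> \<open>The reduced residue is nonnegative, so the root can later serve as the base of a
    natural exponent.\<close>
  have "[(y mod int p) ^ 2 = - 1] (mod int p)"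
    using y by (simp add: cong_def power_mod)
  then show ?thesis
    using that[of "nat (y mod int p)"] \<open>p > 0\<close> by simp
qed

text \<open>Each further \<open>p\<close>-th power gains a factor \<open>p\<close>: in
  \<open>u^p - v^p = (u - v) * S\<close> the cofactor \<open>S\<close> is congruent to
  \<open>p * v^(p - 1)\<close>, hence to 0, modulo \<open>p\<close>.\<close>

lemma cong_power_prime_power:
  fixes x y :: int
  assumes "[x = y] (mod int p)"
  shows "[x ^ p ^ n = y ^ p ^ n] (mod int (p ^ Suc n))"
proof (induction n)
  case 0
  then show ?case using assms by simp
next
  case (Suc n)
  let ?u = "x ^ p ^ n" and ?v = "y ^ p ^ n"
  have "[(\<Sum>i<p. ?v ^ (p - Suc i) * ?u ^ i) = (\<Sum>i<p. ?v ^ (p - Suc i) * ?v ^ i)] (mod int p)"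
  proof (intro cong_sum cong_mult cong_refl cong_pow)
    show "[x = y] (mod int p)"
      by (rule assms)
  qed
  also have "(\<Sum>i<p. ?v ^ (p - Suc i) * ?v ^ i) = (\<Sum>i<p. ?v ^ (p - 1))"
    by (rule sum.cong) (auto simp flip: power_add)
  finally have "int p dvd (\<Sum>i<p. ?v ^ (p - Suc i) * ?u ^ i)"
    by (simp add: cong_dvd_iff)
  moreover have "int (p ^ Suc n) dvd ?u - ?v"
    using Suc.IH by (simp add: cong_iff_dvd_diff)
  ultimately have "int (p ^ Suc n) * int p dvd ?u ^ p - ?v ^ p"
    unfolding power_diff_sumr2 by (rule mult_dvd_mono[rotated])
  then show ?case
    by (simp add: cong_iff_dvd_diff power_mult[symmetric] mult.commute)
qed

lemma power_eq_if_cong: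
  fixes z :: "'a :: monoid_mult"
  assumes "z ^ n = 1" "[a = b] (mod n)"
  shows "z ^ a = z ^ b"
proof -
  have "z ^ c = z ^ (c mod n)" for c
    using assms(1) by (metis div_mult_mod_eq mult.commute mult_1_left power_add power_mult power_one)
  with assms(2) show ?thesis
    by (metis cong_def)
qed

text \<open>The sequence \<open>b ^ p ^ m\<close> converges \<open>p\<close>-adically: its terms
  agree modulo \<open>p ^ n\<close> from \<open>m = n\<close> on, and \<open>z\<close> only sees
  exponents modulo \<open>p ^ n\<close>.\<close>

lemma power_frobenius_stable:
  fixes z :: "'a :: monoid_mult"
  assumes p: "prime p" and z: "z ^ p ^ n = 1" and "n \<le> m"
  shows "z ^ (b ^ p ^ m) = z ^ (b ^ p ^ n)"
  using \<open>n \<le> m\<close>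
proof (induction m rule: dec_induct)
  case (step m)
  have "[int b ^ p = int b] (mod int p)"
  proof (cases "p dvd b")
    case True
    then have "int p dvd int b" "int b dvd int b ^ p"
      using p by (simp_all add: prime_gt_0_nat)
    then show ?thesis
      unfolding cong_iff_dvd_diff by (meson dvd_diff dvd_trans)
  next
    case False
    then have "[b ^ (p - 1) * b = 1 * b] (mod p)"
      by (intro cong_mult fermat_theorem[OF p] cong_refl)
    then have "[b ^ p = b] (mod p)"
      using p by (simp add: prime_gt_0_nat flip: power_Suc2)
    then show ?thesis
      by (metis cong_int_iff of_nat_power)
  qed
  \<comment> \<open>Fermat's congruence modulo \<open>p\<close> is lifted to modulus
    \<open>p ^ Suc m\<close>.\<close>
  then have "[(int b ^ p) ^ p ^ m = int b ^ p ^ m] (mod int (p ^ Suc m))"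
    by (rule cong_power_prime_power)
  then have "[b ^ p ^ Suc m = b ^ p ^ m] (mod p ^ Suc m)"
    by (simp add: power_mult[symmetric] flip: cong_int_iff)
  then have "[b ^ p ^ Suc m = b ^ p ^ m] (mod p ^ n)"
    using step by (meson cong_dvd_modulus_nat le_imp_power_dvd le_SucI)
  then show ?case
    using power_eq_if_cong[OF z] step by metis
qed simp

text \<open>The automorphism raises to the power \<open>lim b ^ p ^ n\<close>, the Teichmueller representative of a
  square root \<open>b\<close> of \<open>-1\<close> modulo \<open>p\<close>. It is a square root of \<open>-1\<close> in the \<open>p\<close>-adic integers.\<close>

lemma squares_to_inv_pruefer_group:
  assumes p: "prime p" "p mod 4 = 1"
  shows "\<exists>J. squares_to_inv (pruefer_group p) J"
proof -
  interpret P: comm_group "pruefer_group p"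
    using p by (intro comm_group_pruefer_group prime_gt_0_nat)
  have carrier: "z \<in> carrier (pruefer_group p) \<longleftrightarrow> (\<exists>n. z ^ p ^ n = 1)" for z
    by (simp add: pruefer_group_def)
  have mult: "x \<otimes>\<^bsub>pruefer_group p\<^esub> y = x * y" and one: "\<one>\<^bsub>pruefer_group p\<^esub> = 1" for x y
    by (simp_all add: pruefer_group_def)
  obtain b :: nat where b: "[int b ^ 2 = - 1] (mod int p)"
    using exists_sqrt_minus_one_mod_prime[OF p] .
  \<comment> \<open>\<open>LEAST\<close> merely selects one \<open>n\<close> with
    \<open>z ^ p ^ n = 1\<close>. By stability every other such \<open>n\<close> gives the same
    value, which the next fact records.\<close>
  define J :: "complex \<Rightarrow> complex" where "J z = z ^ (b ^ p ^ (LEAST n. z ^ p ^ n = 1))" for z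
  have J: "J z = z ^ (b ^ p ^ n)" if "z ^ p ^ n = 1" for z n
    unfolding J_def using that
    by (intro power_frobenius_stable[OF p(1), symmetric]) (auto intro: LeastI Least_le)
  have upward: "z ^ p ^ (m + n) = 1" if "z ^ p ^ m = 1" for z :: complex and m n
    using that by (simp add: power_add power_mult)
  have killed: "J z ^ p ^ n = 1" if "z ^ p ^ n = 1" for z n
    using that by (simp add: J mult.commute flip: power_mult) (simp add: power_mult)
  have "J (x * y) = J x * J y" if "x ^ p ^ m = 1" "y ^ p ^ n = 1" for x y m n
  proof -
    \<comment> \<open>With a common exponent for \<open>x\<close> and \<open>y\<close>,
      \<open>J\<close> acts on both as one and the same power map.\<close>
    have "x ^ p ^ (m + n) = 1" "y ^ p ^ (m + n) = 1"
      using upward[OF that(1), of n] upward[OF that(2), of m] by (simp_all add: add.commute)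
    then show ?thesis
      using J[of _ "m + n"] by (simp add: power_mult_distrib)
  qed
  with killed have "J \<in> hom (pruefer_group p) (pruefer_group p)"
    by (fastforce simp: hom_def carrier mult)
  moreover have "J (J z) = inv\<^bsub>pruefer_group p\<^esub> z" if z: "z \<in> carrier (pruefer_group p)" for z
  proof -
    obtain n where n: "z ^ p ^ n = 1"
      using z carrier by blast
    \<comment> \<open>Lifting turns \<open>b ^ p ^ n\<close> into a square root of -1 modulo
      \<open>p ^ n\<close>; the sign survives because \<open>p ^ n\<close> is odd.\<close>
    have "[(int b ^ 2) ^ p ^ n = (- 1) ^ p ^ n] (mod int (p ^ Suc n))"
      using b by (rule cong_power_prime_power)
    moreover have "odd (p ^ n)"
      using p(2) by (simp, presburger)
    ultimately have "int (p ^ n) dvd (int b ^ 2) ^ p ^ n + 1"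
      by (auto simp: cong_iff_dvd_diff dest: dvd_mult_right)
    then have "int (p ^ n) dvd int ((b ^ p ^ n) ^ 2 + 1)"
      by (simp add: ac_simps flip: power_mult)
    then have "p ^ n dvd (b ^ p ^ n) ^ 2 + 1"
      unfolding int_dvd_int_iff .
    then have "z ^ ((b ^ p ^ n) ^ 2 + 1) = 1"
      using n by (metis dvdE power_mult power_one)
    moreover have "J (J z) = z ^ ((b ^ p ^ n) ^ 2)"
      unfolding J[OF killed[OF n]] by (simp add: J[OF n] power2_eq_square flip: power_mult)
    ultimately have "J (J z) * z = 1"
      by (simp add: power_add mult.commute)
    then show ?thesis
      using z killed[OF killed[OF n]] by (intro P.inv_equality[symmetric]) (auto simp: mult one carrier)
  qed
  ultimately show ?thesis
    unfolding squares_to_inv_def by blast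
qed

section \<open>Counting torsion\<close>

definition torsion :: "nat \<Rightarrow> ('a, 'm) monoid_scheme \<Rightarrow> 'a set" where
  "torsion n G = {x \<in> carrier G. x [^]\<^bsub>G\<^esub> n = \<one>\<^bsub>G\<^esub>}"

lemma pow_sum_group:
  assumes "\<And>i. i \<in> I \<Longrightarrow> group (G i)" "x \<in> carrier (sum_group I G)"
  shows "x [^]\<^bsub>sum_group I G\<^esub> (n :: nat) = (\<lambda>i\<in>I. x i [^]\<^bsub>G i\<^esub> n)"
proof (induction n)
  case (Suc n)
  then show ?case
    by (simp cong: restrict_cong)
qed simp

lemma pow_DirProd: "x [^]\<^bsub>G \<times>\<times> H\<^esub> (n :: nat) = (fst x [^]\<^bsub>G\<^esub> n, snd x [^]\<^bsub>H\<^esub> n)"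
  by (induction n) (simp_all add: mult_DirProd')

lemma torsion_DirProd: "torsion n (G \<times>\<times> H) = torsion n G \<times> torsion n H"
  by (auto simp: torsion_def pow_DirProd)

lemma torsion_sum_group:
  assumes G: "\<And>i. i \<in> I \<Longrightarrow> group (G i)"
  shows "torsion n (sum_group I G) = {x \<in> \<Pi>\<^sub>E i\<in>I. torsion n (G i). finite {i \<in> I. x i \<noteq> \<one>\<^bsub>G i\<^esub>}}"
proof -
  have "x [^]\<^bsub>sum_group I G\<^esub> n = \<one>\<^bsub>sum_group I G\<^esub> \<longleftrightarrow> (\<forall>i\<in>I. x i [^]\<^bsub>G i\<^esub> n = \<one>\<^bsub>G i\<^esub>)"
    if "x \<in> carrier (sum_group I G)" for x
    by (auto simp: pow_sum_group[OF G that] fun_eq_iff)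
  then show ?thesis
    by (auto simp: torsion_def carrier_sum_group[OF G] PiE_iff)
qed

lemma one_in_torsion: "group G \<Longrightarrow> \<one>\<^bsub>G\<^esub> \<in> torsion n G"
  by (simp add: torsion_def group.is_monoid monoid.nat_pow_one)

lemma card_torsion_sum_group_finite:
  assumes G: "\<And>i. i \<in> I \<Longrightarrow> group (G i)" and I: "finite I"
  shows "card (torsion n (sum_group I G)) = (\<Prod>i\<in>I. card (torsion n (G i)))"
proof -
  have "torsion n (sum_group I G) = (\<Pi>\<^sub>E i\<in>I. torsion n (G i))"
    using I by (auto simp: torsion_sum_group[OF G])
  then show ?thesis
    using I by (simp add: card_PiE)
qed

text \<open>Meant for the sum over all primes, where the index set is infinite but only one summand
  contributes \<open>n\<close>-torsion.\<close>

lemma card_torsion_sum_group_single: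
  assumes G: "\<And>i. i \<in> I \<Longrightarrow> group (G i)" and k: "k \<in> I"
    and triv: "\<And>i. i \<in> I \<Longrightarrow> i \<noteq> k \<Longrightarrow> torsion n (G i) = {\<one>\<^bsub>G i\<^esub>}"
  shows "card (torsion n (sum_group I G)) = card (torsion n (G k))"
proof -
  have "bij_betw (\<lambda>x. x k) (torsion n (sum_group I G)) (torsion n (G k))"
  proof (rule bij_betw_byWitness[where f' = "\<lambda>y. \<lambda>i\<in>I. if i = k then y else \<one>\<^bsub>G i\<^esub>"])
    show "\<forall>x\<in>torsion n (sum_group I G). (\<lambda>i\<in>I. if i = k then x k else \<one>\<^bsub>G i\<^esub>) = x"
    proof
      fix x assume x: "x \<in> torsion n (sum_group I G)"
      show "(\<lambda>i\<in>I. if i = k then x k else \<one>\<^bsub>G i\<^esub>) = x"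
      proof
        fix i show "(\<lambda>i\<in>I. if i = k then x k else \<one>\<^bsub>G i\<^esub>) i = x i"
          using x triv[of i] by (auto simp: torsion_sum_group[OF G] PiE_iff extensional_def)
      qed
    qed
    show "(\<lambda>y. \<lambda>i\<in>I. if i = k then y else \<one>\<^bsub>G i\<^esub>) ` torsion n (G k) \<subseteq> torsion n (sum_group I G)"
    proof (intro image_subsetI)
      fix y assume y: "y \<in> torsion n (G k)"
      have "finite {i \<in> I. (\<lambda>i\<in>I. if i = k then y else \<one>\<^bsub>G i\<^esub>) i \<noteq> \<one>\<^bsub>G i\<^esub>}"
        by (rule finite_subset[of _ "{k}"]) auto
      then show "(\<lambda>i\<in>I. if i = k then y else \<one>\<^bsub>G i\<^esub>) \<in> torsion n (sum_group I G)"
        using y one_in_torsion[OF G] by (simp add: torsion_sum_group[OF G])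
    qed
  qed (use k in \<open>auto simp: torsion_sum_group[OF G]\<close>)
  then show ?thesis
    by (rule bij_betw_same_card)
qed

section \<open>Torsion of the rational group and the Pruefer groups\<close>

lemma mult_rat_group: "x \<otimes>\<^bsub>rat_group\<^esub> y = x + y"
  by (simp add: rat_group_def)

lemma one_rat_group: "\<one>\<^bsub>rat_group\<^esub> = 0"
  by (simp add: rat_group_def)

lemma mult_pruefer_group: "x \<otimes>\<^bsub>pruefer_group p\<^esub> y = x * y"
  by (simp add: pruefer_group_def)

lemma one_pruefer_group: "\<one>\<^bsub>pruefer_group p\<^esub> = 1"
  by (simp add: pruefer_group_def)

lemma pow_rat_group: "x [^]\<^bsub>rat_group\<^esub> (n :: nat) = of_nat n * x"
  by (induction n) (simp_all add: mult_rat_group one_rat_group algebra_simps)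

lemma torsion_rat_group: "n > 0 \<Longrightarrow> torsion n rat_group = {\<one>\<^bsub>rat_group\<^esub>}"
  unfolding torsion_def pow_rat_group by (auto simp: rat_group_def)

lemma pow_pruefer_group: "x [^]\<^bsub>pruefer_group p\<^esub> (n :: nat) = x ^ n"
  by (induction n) (simp_all add: mult_pruefer_group one_pruefer_group mult.commute)

lemma torsion_pruefer_group: "torsion n (pruefer_group p) = {z. z ^ n = 1 \<and> (\<exists>k. z ^ p ^ k = 1)}"
  unfolding torsion_def pow_pruefer_group by (auto simp: pruefer_group_def)

lemma group_pruefer_group: "prime p \<Longrightarrow> group (pruefer_group p)"
  by (simp add: comm_group_pruefer_group comm_group.axioms(2) prime_gt_0_nat)

lemma group_rat_group: "group rat_group"
  by (rule comm_group.axioms(2)[OF comm_group_rat_group])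

lemma card_torsion_pruefer_group:
  assumes "p > 0"
  shows "card (torsion p (pruefer_group p)) = p"
proof -
  have "torsion p (pruefer_group p) = {z. z ^ p = 1}"
    unfolding torsion_pruefer_group by (auto intro: exI[of _ 1])
  then show ?thesis
    using assms by (simp add: card_roots_unity_eq)
qed

text \<open>Coprimality of \<open>p\<close> and \<open>q ^ k\<close> forces the order to be 1.
  Bezout is used in its additive form, so that all exponents stay natural.\<close>

lemma torsion_pruefer_group_other_prime:
  assumes "prime p" "prime q" "q \<noteq> p"
  shows "torsion p (pruefer_group q) = {\<one>\<^bsub>pruefer_group q\<^esub>}"
proof -
  have "z = 1" if "z ^ p = 1" "z ^ q ^ k = 1" for z :: complex and k
  proof -
    have "coprime p (q ^ k)"
      using assms by (simp add: primes_coprime)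
    then obtain a b where "p * a = q ^ k * b + 1"
      using bezout_nat[of p "q ^ k"] assms by (auto simp: prime_gt_0_nat)
    then have "z ^ (p * a) = z ^ (q ^ k * b + 1)"
      by simp
    then show ?thesis
      using that by (simp add: power_mult power_add)
  qed
  then show ?thesis
    unfolding torsion_pruefer_group by (auto simp: pruefer_group_def)
qed

lemma torsion_sum_group_trivial:
  assumes G: "\<And>i. i \<in> I \<Longrightarrow> group (G i)"
    and triv: "\<And>i. i \<in> I \<Longrightarrow> torsion n (G i) = {\<one>\<^bsub>G i\<^esub>}"
  shows "torsion n (sum_group I G) = {\<one>\<^bsub>sum_group I G\<^esub>}"
proof -
  have "x = \<one>\<^bsub>sum_group I G\<^esub>" if "x \<in> torsion n (sum_group I G)" for x
    using that triv by (auto simp: torsion_sum_group[OF G] PiE_iff extensional_def fun_eq_iff)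
  then have "torsion n (sum_group I G) \<subseteq> {\<one>\<^bsub>sum_group I G\<^esub>}"
    by (intro subsetI) (simp only: singleton_iff)
  moreover have "\<one>\<^bsub>sum_group I G\<^esub> \<in> torsion n (sum_group I G)"
    using G by (intro one_in_torsion sum_group)
  ultimately show ?thesis
    by (intro subset_antisym insert_subsetI empty_subsetI)
qed

section \<open>Constraints that \<open>J\<close> imposes on torsion\<close>

lemma (in group) hom_in_torsion:
  assumes "group_hom G G J" "x \<in> torsion n G"
  shows "J x \<in> torsion n G"
proof -
  interpret group_hom G G J by fact
  show ?thesis
    using assms(2) hom_nat_pow[of x n, symmetric] by (simp add: torsion_def)
qed

text \<open>The orbits of \<open>f\<close> all have four elements.\<close>

lemma four_dvd_card:
  assumes X: "finite X" and f: "\<And>x. x \<in> X \<Longrightarrow> f x \<in> X"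
    and f4: "\<And>x. x \<in> X \<Longrightarrow> f (f (f (f x))) = x" and f2: "\<And>x. x \<in> X \<Longrightarrow> f (f x) \<noteq> x"
  shows "4 dvd card X"
proof -
  define orb where "orb x = {x, f x, f (f x), f (f (f x))}" for x
  have orb_eq: "orb y = orb x" if "x \<in> X" "y \<in> orb x" for x y
    using that f4[OF that(1)] unfolding orb_def by auto
  have "4 * card (orb ` X) = card (\<Union> (orb ` X))"
  proof (rule card_partition)
    show "card c = 4" if c: "c \<in> orb ` X" for c
    proof -
      obtain x where x: "x \<in> X" "c = orb x"
        using c by blast
      \<comment> \<open>Any coincidence within an orbit would, by \<open>f4\<close>, give a point
        fixed by the square of \<open>f\<close>.\<close>
      have "f x \<noteq> x" "f (f x) \<noteq> x" "f (f x) \<noteq> f x" "f (f (f x)) \<noteq> x" "f (f (f x)) \<noteq> f x"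
        "f (f (f x)) \<noteq> f (f x)"
        using x f f2 f4 by metis+
      then show ?thesis
        by (simp add: x orb_def card_insert_if)
    qed
    show "c1 \<inter> c2 = {}" if "c1 \<in> orb ` X" "c2 \<in> orb ` X" "c1 \<noteq> c2" for c1 c2
      using that orb_eq by blast
  qed (use X in \<open>auto simp: orb_def\<close>)
  moreover have "\<Union> (orb ` X) = X"
    using f by (auto simp: orb_def)
  ultimately show ?thesis
    by (metis dvd_triv_left)
qed

text \<open>\<open>J\<close> permutes the nontrivial \<open>n\<close>-torsion with fourth power the
  identity. Its square is inversion, which fixes no nontrivial element of odd torsion. The
  subtracted 1 accounts for the identity.\<close>

lemma (in group) four_dvd_card_torsion:
  assumes J: "squares_to_inv G J" and n: "odd n" and fin: "finite (torsion n G)"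
  shows "4 dvd card (torsion n G) - 1"
proof -
  interpret group_hom G G J
    by (rule squares_to_inv_group_hom[OF J])
  note JJ = squares_to_invD(2)[OF J]
  have "4 dvd card (torsion n G - {\<one>})"
  proof (rule four_dvd_card[of _ J])
    fix x assume x: "x \<in> torsion n G - {\<one>}"
    then have xc: "x \<in> carrier G" and xn: "x [^] n = \<one>"
      by (auto simp: torsion_def)
    show J4: "J (J (J (J x))) = x"
      using xc by (simp add: JJ)
    have "J x \<noteq> \<one>"
      using J4 x by auto
    then show "J x \<in> torsion n G - {\<one>}"
      using x hom_in_torsion group_hom_axioms by blast
    show "J (J x) \<noteq> x"
    proof
      assume "J (J x) = x"
      then have "inv x = x"
        using JJ[OF xc] by simp
      then have x2: "x [^] (2::nat) = \<one>"
        using xc r_inv[OF xc] by (simp add: numeral_2_eq_2)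
      obtain m where "n = 2 * m + 1"
        using n oddE by blast
      then have "x [^] n = x"
        using xc x2 by (simp add: nat_pow_mult[symmetric] nat_pow_pow[symmetric])
      then show False
        using x xn by auto
    qed
  qed (use fin in auto)
  then show ?thesis
    using one_in_torsion[OF is_group] by simp
qed

text \<open>Regard \<open>G\<close> as a module over the Gaussian integers, \<open>J\<close> being \<open>\<i>\<close>. Multiplication by
  \<open>1 + \<i>\<close> has kernel \<open>K\<close>, and it maps the 2-torsion onto \<open>K\<close>
  because \<open>2 = (1 + \<i>) (1 - \<i>)\<close> is surjective on \<open>G\<close>.\<close>

lemma (in comm_group) card_two_torsion_square:
  assumes J: "squares_to_inv G J" and div: "divisible_group G"
  shows "\<exists>c. card (torsion 2 G) = c ^ 2"
proof -
  interpret group_hom G G J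
    by (rule squares_to_inv_group_hom[OF J])
  note JJ = squares_to_invD(2)[OF J]
  let ?T = "torsion 2 G"
  \<comment> \<open>This is also the kernel of \<open>1 + J\<close>, since
    \<open>1 - J = -J (1 + J)\<close> and \<open>J\<close> is injective.\<close>
  define K where "K = {x \<in> carrier G. J x = x}"
  have T: "x \<in> ?T \<longleftrightarrow> x \<in> carrier G \<and> inv x = x" for x
    unfolding torsion_def
    by (auto simp: numeral_2_eq_2) (metis inv_equality, metis r_inv)
  have KT: "x \<in> ?T" if "x \<in> K" for x
    using that JJ[of x] by (auto simp: K_def T)
  have "\<exists>u. u \<in> ?T \<and> u \<otimes> J u = y" if y: "y \<in> K" for y
  proof -
    have yc: "y \<in> carrier G" "J y = y" "inv y = y"
      using y KT[OF y] by (auto simp: K_def T)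
    obtain z where z: "z \<in> carrier G" "z \<otimes> z = y"
      using div yc(1) unfolding divisible_group_def
      by (metis numeral_2_eq_2 nat_pow_Suc nat_pow_0 l_one zero_less_numeral)
    \<comment> \<open>Additively \<open>u = (1 - J) z\<close> with \<open>2 z = y\<close>. Hence
      \<open>(1 + J) u = 2 z = y\<close>, while \<open>2 u = (1 - J) y = 0\<close>.\<close>
    let ?u = "z \<otimes> inv (J z)"
    have u1: "?u \<otimes> J ?u = y"
      using z JJ[of z] by (simp add: m_ac)
    have "?u \<otimes> ?u = y \<otimes> inv (J y)"
      using z by (simp add: m_ac inv_mult flip: z(2))
    then have "?u \<otimes> ?u = \<one>"
      using yc r_inv[OF yc(1)] by simp
    then have "inv ?u = ?u"
      using z by (simp add: inv_equality)
    then show ?thesis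
      using u1 z T by (intro exI[of _ ?u]) simp
  qed
  then obtain s where s: "\<And>y. y \<in> K \<Longrightarrow> s y \<in> ?T" "\<And>y. y \<in> K \<Longrightarrow> s y \<otimes> J (s y) = y"
    by metis
  \<comment> \<open>\<open>s\<close> is a set-theoretic section of \<open>1 + J\<close> from the
    2-torsion onto \<open>K\<close>. As the kernel is again \<open>K\<close>, each 2-torsion element
    is uniquely \<open>k\<close> plus a chosen preimage.\<close>
  have "bij_betw (\<lambda>(k, y). k \<otimes> s y) (K \<times> K) ?T"
  proof (rule bij_betw_byWitness[where f' = "\<lambda>x. (x \<otimes> inv (s (x \<otimes> J x)), x \<otimes> J x)"])
    have K_self_inverse: "k \<otimes> k = \<one>" if "k \<in> K" for k
      using that KT[OF that] r_inv[of k] by (auto simp: T)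
    have phi: "k \<otimes> s y \<otimes> J (k \<otimes> s y) = y" if "k \<in> K" "y \<in> K" for k y
    proof -
      have c: "k \<in> carrier G" "s y \<in> carrier G" "J k = k" "y \<in> carrier G"
        using that s(1)[OF that(2)] by (auto simp: K_def T)
      have "k \<otimes> s y \<otimes> J (k \<otimes> s y) = (k \<otimes> k) \<otimes> (s y \<otimes> J (s y))"
        using c by (simp add: m_ac)
      then show ?thesis
        using that c s(2) K_self_inverse by simp
    qed
    show "\<forall>a\<in>K \<times> K. (\<lambda>x. (x \<otimes> inv (s (x \<otimes> J x)), x \<otimes> J x)) ((\<lambda>(k, y). k \<otimes> s y) a) = a"
    proof safe
      fix k y assume ky: "k \<in> K" "y \<in> K"
      then have "k \<in> carrier G" "s y \<in> carrier G"
        using s(1) by (auto simp: K_def T)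
      then show "k \<otimes> s y \<otimes> inv (s (k \<otimes> s y \<otimes> J (k \<otimes> s y))) = k" 
        unfolding phi[OF ky] by (simp add: m_assoc)
      show "k \<otimes> s y \<otimes> J (k \<otimes> s y) = y"
        by (rule phi[OF ky])
    qed
    have phiK: "x \<otimes> J x \<in> K" if "x \<in> ?T" for x
      using that JJ[of x] by (simp add: K_def T m_comm)
    show "\<forall>x\<in>?T. (\<lambda>(k, y). k \<otimes> s y) (x \<otimes> inv (s (x \<otimes> J x)), x \<otimes> J x) = x"
    proof
      fix x assume x: "x \<in> ?T"
      then have "x \<in> carrier G" "s (x \<otimes> J x) \<in> carrier G"
        using s(1)[OF phiK[OF x]] by (auto simp: T)
      then show "(\<lambda>(k, y). k \<otimes> s y) (x \<otimes> inv (s (x \<otimes> J x)), x \<otimes> J x) = x"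
        by (simp add: m_assoc)
    qed
    show "(\<lambda>(k, y). k \<otimes> s y) ` (K \<times> K) \<subseteq> ?T"
      using s(1) KT by (auto simp: T inv_mult)
    show "(\<lambda>x. (x \<otimes> inv (s (x \<otimes> J x)), x \<otimes> J x)) ` ?T \<subseteq> K \<times> K"
    proof safe
      fix x assume x: "x \<in> ?T"
      let ?y = "x \<otimes> J x" and ?s = "s (x \<otimes> J x)"
      show "?y \<in> K"
        by (rule phiK[OF x])
      have xc: "x \<in> carrier G" "inv x = x" and sc: "?s \<in> carrier G" "inv ?s = ?s"
        using x s(1)[OF phiK[OF x]] by (auto simp: T)
      \<comment> \<open>Both \<open>x\<close> and its representative \<open>s (x + J x)\<close> have
        the same image \<open>y\<close> under \<open>1 + J\<close>. So \<open>J\<close> adds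
        \<open>y\<close> to each, and the two contributions cancel because
        \<open>2 y = 0\<close>.\<close>
      have "J x = inv x \<otimes> ?y" "J ?s = inv ?s \<otimes> ?y"
        using xc sc s(2)[OF phiK[OF x]] by (metis inv_solve_left hom_closed m_closed)+
      then have eqs: "J x = x \<otimes> ?y" "J ?s = ?s \<otimes> ?y"
        using xc sc by simp_all
      have swap: "(a \<otimes> c) \<otimes> (b \<otimes> c) = (a \<otimes> b) \<otimes> (c \<otimes> c)"
        if "a \<in> carrier G" "b \<in> carrier G" "c \<in> carrier G" for a b c
        using that by (simp add: m_ac)
      have "J (x \<otimes> ?s) = J x \<otimes> J ?s"
        using xc sc by simp
      also have "\<dots> = (x \<otimes> ?y) \<otimes> (?s \<otimes> ?y)"
        by (rule arg_cong2[where f = "(\<otimes>)", OF eqs])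
      also have "\<dots> = (x \<otimes> ?s) \<otimes> (?y \<otimes> ?y)"
        using xc sc by (intro swap) simp_all
      also have "\<dots> = x \<otimes> ?s"
        using xc sc K_self_inverse[OF phiK[OF x]] by simp
      finally show "x \<otimes> inv ?s \<in> K"
        using xc sc by (simp add: K_def)
    qed
  qed
  then have "card ?T = card (K \<times> K)"
    by (simp add: bij_betw_same_card)
  then show ?thesis
    by (auto simp: card_cartesian_product power2_eq_square)
qed

section \<open>The rational part\<close>

text \<open>Integer multiples come out by induction; multiplying by the denominator of
  \<open>q\<close> reduces to that case.\<close>

lemma additive_rat_linear:
  fixes g :: "rat \<Rightarrow> rat"
  assumes add: "\<And>x y. g (x + y) = g x + g y"
  shows "g q = q * g 1"
proof -
  interpret additive g
    using add by unfold_locales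
  have nat: "g (of_nat n * x) = of_nat n * g x" for n x
    by (induction n) (simp_all add: zero add algebra_simps)
  have int: "g (of_int k * x) = of_int k * g x" for k x
    using nat[of "nat \<bar>k\<bar>" x] by (cases "k \<ge> 0") (simp_all add: minus)
  obtain a b where q: "q = Rat.Fract a b" "b > 0"
    by (cases q)
  then have bq: "of_int b * q = of_int a"
    by (simp add: Fract_of_int_quotient)
  have "of_int b * g q = g (of_int a * 1)"
    by (simp add: bq flip: int)
  also have "\<dots> = of_int b * (q * g 1)"
    unfolding int by (simp flip: bq)
  finally show ?thesis
    using q(2) by simp
qed

lemma carrier_direct_power_rat_group:
  "finite I \<Longrightarrow> carrier (direct_power I rat_group) = extensional I"
  by (simp add: carrier_sum_group group_rat_group PiE_def) (simp add: rat_group_def)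

lemma inv_rat_group: "inv\<^bsub>rat_group\<^esub> x = - x"
  by (rule group.inv_equality[OF group_rat_group])
    (simp_all add: mult_rat_group one_rat_group, simp_all add: rat_group_def)

text \<open>Applied to each coordinate of \<open>J\<close>, this supplies the matrix of
  \<open>J\<close>.\<close>

lemma additive_functional_expansion:
  fixes f :: "('i \<Rightarrow> rat) \<Rightarrow> rat"
  assumes I: "finite I" and x: "x \<in> extensional I"
    and add: "\<And>x y. x \<in> extensional I \<Longrightarrow> y \<in> extensional I \<Longrightarrow> f (\<lambda>i\<in>I. x i + y i) = f x + f y"
  shows "f x = (\<Sum>j\<in>I. x j * f (\<lambda>i\<in>I. if i = j then 1 else 0))"
proof -
  have single: "f (\<lambda>i\<in>I. if i = j then q else 0) = q * f (\<lambda>i\<in>I. if i = j then 1 else 0)" for j q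
  proof (rule additive_rat_linear)
    fix a b
    show "f (\<lambda>i\<in>I. if i = j then a + b else 0) =
        f (\<lambda>i\<in>I. if i = j then a else 0) + f (\<lambda>i\<in>I. if i = j then b else 0)"
      by (subst add[symmetric]) (auto intro!: arg_cong[where f = f] restrict_ext)
  qed
  have zero: "f (\<lambda>i\<in>I. 0) = 0"
    using add[of "\<lambda>i\<in>I. 0" "\<lambda>i\<in>I. 0"] by (simp cong: restrict_cong)
  \<comment> \<open>Induction over truncations of \<open>x\<close> to a subset \<open>F\<close> of
    the coordinates.\<close>
  have "f (\<lambda>i\<in>I. if i \<in> F then x i else 0) = (\<Sum>j\<in>F. x j * f (\<lambda>i\<in>I. if i = j then 1 else 0))"
    if "F \<subseteq> I" for F
    using finite_subset[OF that I] that
  proof (induction F rule: finite_induct)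
    case (insert j F)
    have "f (\<lambda>i\<in>I. if i \<in> insert j F then x i else 0) =
        f (\<lambda>i\<in>I. if i = j then x j else 0) + f (\<lambda>i\<in>I. if i \<in> F then x i else 0)"
      using insert.hyps
      by (subst add[symmetric]) (auto intro!: arg_cong[where f = f] restrict_ext)
    also have "f (\<lambda>i\<in>I. if i \<in> F then x i else 0) =
        (\<Sum>j\<in>F. x j * f (\<lambda>i\<in>I. if i = j then 1 else 0))"
      using insert.IH insert.prems by blast
    also have "f (\<lambda>i\<in>I. if i = j then x j else 0) = x j * f (\<lambda>i\<in>I. if i = j then 1 else 0)"
      by (rule single)
    finally show ?case
      by (simp only: sum.insert[OF insert.hyps])
  qed (simp add: zero)
  from this[OF subset_refl] have "f (\<lambda>i\<in>I. x i) = (\<Sum>j\<in>I. x j * f (\<lambda>i\<in>I. if i = j then 1 else 0))"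
    by (simp cong: restrict_cong)
  then show ?thesis
    using x by (simp add: extensional_restrict)
qed

text \<open>For odd \<open>n\<close> the determinant would be a rational number with square
  -1.\<close>

lemma even_dim_if_square_minus_one:
  fixes A :: "rat mat"
  assumes A: "A \<in> carrier_mat n n" and "A * A = - 1 \<cdot>\<^sub>m 1\<^sub>m n"
  shows "even n"
proof (rule ccontr)
  assume "odd n"
  have "det A * det A = det (- 1 \<cdot>\<^sub>m 1\<^sub>m n :: rat mat)"
    using assms by (metis det_mult)
  also have "\<dots> = - 1"
    using \<open>odd n\<close> by simp
  finally show False
    by (metis neg_0_le_iff_le not_one_le_zero zero_le_square)
qed

lemma even_card_if_squares_to_inv_rat:
  assumes I: "finite I" and J: "squares_to_inv (direct_power I rat_group) J"
  shows "even (card I)"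
proof -
  let ?H = "direct_power I rat_group"
  note carrier = carrier_direct_power_rat_group[OF I]
  define e where "e j = (\<lambda>i\<in>I. if i = j then 1 else (0::rat))" for j
  have closed: "x \<in> extensional I \<Longrightarrow> J x \<in> extensional I" for x
    using squares_to_invD(1)[OF J] by (simp add: carrier)
  have JJ: "J (J x) = (\<lambda>i\<in>I. - x i)" if "x \<in> extensional I" for x
    using squares_to_invD(2)[OF J, of x] that
    by (simp add: carrier inv_sum_group group_rat_group inv_rat_group)
  have expand: "J x i = (\<Sum>j\<in>I. x j * J (e j) i)" if "x \<in> extensional I" "i \<in> I" for x i
    unfolding e_def
  proof (rule additive_functional_expansion[OF I, where f = "\<lambda>x. J x i"])
    fix y z :: "_ \<Rightarrow> rat" assume "y \<in> extensional I" "z \<in> extensional I"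
    then have "J (y \<otimes>\<^bsub>?H\<^esub> z) = J y \<otimes>\<^bsub>?H\<^esub> J z"
      using J by (auto simp: squares_to_inv_def hom_def carrier)
    then show "J (\<lambda>i\<in>I. y i + z i) i = J y i + J z i"
      using that by (simp add: mult_rat_group)
  qed (use that in simp)
  \<comment> \<open>The entries of the squared matrix, still indexed by \<open>I\<close>.\<close>
  have JJe: "(\<Sum>j\<in>I. J (e k) j * J (e j) i) = (if i = k then - 1 else 0)" if "i \<in> I" for i k
  proof -
    have "e k \<in> extensional I"
      by (simp add: e_def)
    then have "(\<Sum>j\<in>I. J (e k) j * J (e j) i) = - e k i"
      using expand[OF closed that, of "e k"] JJ[of "e k"] that by simp
    then show ?thesis
      using that by (simp add: e_def)
  qed
  obtain b where b: "bij_betw b {0..<card I} I"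
    using ex_bij_betw_nat_finite[OF I] by blast
  \<comment> \<open>Column \<open>j\<close> holds the image of the unit family at
    \<open>b j\<close>; \<open>b\<close> numbers the index set, as matrices require.\<close>
  define A where "A = mat (card I) (card I) (\<lambda>(i, j). J (e (b j)) (b i))"
  have "A * A = - 1 \<cdot>\<^sub>m 1\<^sub>m (card I)"
  proof (rule eq_matI)
    fix i k assume "i < dim_row (- 1 \<cdot>\<^sub>m 1\<^sub>m (card I) :: rat mat)" "k < dim_col (- 1 \<cdot>\<^sub>m 1\<^sub>m (card I) :: rat mat)"
    then have ik: "i < card I" "k < card I"
      by auto
    have "(A * A) $$ (i, k) = (\<Sum>j = 0..<card I. J (e (b j)) (b i) * J (e (b k)) (b j))"
      using ik by (simp add: A_def scalar_prod_def)
    also have "\<dots> = (\<Sum>j\<in>I. J (e j) (b i) * J (e (b k)) j)"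
      by (rule sum.reindex_bij_betw[OF b])
    also have "\<dots> = (if b i = b k then - 1 else 0)"
      using JJe[of "b i" "b k"] bij_betwE[OF b] ik by (simp add: mult.commute)
    also have "b i = b k \<longleftrightarrow> i = k"
      using ik bij_betw_imp_inj_on[OF b] by (auto dest: inj_onD)
    finally show "(A * A) $$ (i, k) = (- 1 \<cdot>\<^sub>m 1\<^sub>m (card I)) $$ (i, k)"
      using ik by simp
  qed (auto simp: A_def)
  then show ?thesis
    by (intro even_dim_if_square_minus_one[of A]) (auto simp: A_def)
qed

text \<open>\<open>S\<close> is the torsion subgroup of the product, so \<open>J\<close> preserves
  it and descends to the quotient, which is identified with \<open>A\<close>.\<close>

lemma squares_to_inv_torsion_free_part:
  assumes A: "group A" and S: "group S" and J: "squares_to_inv (A \<times>\<times> S) J"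
    and tf: "\<And>n. n > 0 \<Longrightarrow> torsion n A = {\<one>\<^bsub>A\<^esub>}"
    and tor: "\<And>s. s \<in> carrier S \<Longrightarrow> \<exists>n>0. s \<in> torsion n S"
  shows "squares_to_inv A (\<lambda>x. fst (J (x, \<one>\<^bsub>S\<^esub>)))"
proof -
  interpret A: group A by fact
  interpret S: group S by fact
  interpret P: group "A \<times>\<times> S"
    using A S by (rule DirProd_group)
  interpret J: group_hom "A \<times>\<times> S" "A \<times>\<times> S" J
    by (rule P.squares_to_inv_group_hom[OF J])
  have closed: "fst (J (x, s)) \<in> carrier A" "snd (J (x, s)) \<in> carrier S"
    if "x \<in> carrier A" "s \<in> carrier S" for x s
    using J.hom_closed[of "(x, s)"] that by (simp_all add: mem_Times_iff)
  have mult: "fst (J (x \<otimes>\<^bsub>A\<^esub> y, s \<otimes>\<^bsub>S\<^esub> t)) = fst (J (x, s)) \<otimes>\<^bsub>A\<^esub> fst (J (y, t))"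
    if "x \<in> carrier A" "s \<in> carrier S" "y \<in> carrier A" "t \<in> carrier S" for x s y t
    using J.hom_mult[of "(x, s)" "(y, t)"] that by (simp add: mult_DirProd')
  have S1: "fst (J (\<one>\<^bsub>A\<^esub>, s)) = \<one>\<^bsub>A\<^esub>" if s: "s \<in> carrier S" for s
  proof -
    obtain n where n: "n > 0" "s \<in> torsion n S"
      using tor[OF s] by blast
    then have "(\<one>\<^bsub>A\<^esub>, s) \<in> torsion n (A \<times>\<times> S)"
      using A by (simp add: torsion_DirProd one_in_torsion)
    then have "J (\<one>\<^bsub>A\<^esub>, s) \<in> torsion n A \<times> torsion n S"
      unfolding torsion_DirProd[symmetric]
      by (rule P.hom_in_torsion[OF J.group_hom_axioms])
    with tf[OF n(1)] show ?thesis
      by (auto simp: mem_Times_iff)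
  qed
  \<comment> \<open>The induced map is independent of the representative modulo
    \<open>S\<close>.\<close>
  have absorb: "fst (J (x, s)) = fst (J (x, \<one>\<^bsub>S\<^esub>))" if "x \<in> carrier A" "s \<in> carrier S" for x s
    using mult[of x "\<one>\<^bsub>S\<^esub>" "\<one>\<^bsub>A\<^esub>" s] that closed S1 by simp
  have "fst (J (fst (J (x, \<one>\<^bsub>S\<^esub>)), \<one>\<^bsub>S\<^esub>)) = inv\<^bsub>A\<^esub> x" if x: "x \<in> carrier A" for x
  proof -
    have "fst (J (fst (J (x, \<one>\<^bsub>S\<^esub>)), \<one>\<^bsub>S\<^esub>)) = fst (J (J (x, \<one>\<^bsub>S\<^esub>)))"
      using absorb[of "fst (J (x, \<one>\<^bsub>S\<^esub>))" "snd (J (x, \<one>\<^bsub>S\<^esub>))"] closed[OF x] by simp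
    then show ?thesis
      using x squares_to_invD(2)[OF J, of "(x, \<one>\<^bsub>S\<^esub>)"] A S by simp
  qed
  then show ?thesis
    using closed(1) mult[of _ "\<one>\<^bsub>S\<^esub>" _ "\<one>\<^bsub>S\<^esub>"] by (simp add: squares_to_inv_def hom_def)
qed

lemma sum_group_of_torsion_groups:
  assumes G: "\<And>i. i \<in> I \<Longrightarrow> group (G i)"
    and tor: "\<And>i x. i \<in> I \<Longrightarrow> x \<in> carrier (G i) \<Longrightarrow> \<exists>n>0. x \<in> torsion n (G i)"
    and x: "x \<in> carrier (sum_group I G)"
  shows "\<exists>n>0. x \<in> torsion n (sum_group I G)"
proof -
  let ?F = "{i \<in> I. x i \<noteq> \<one>\<^bsub>G i\<^esub>}"
  have mem: "x i \<in> carrier (G i)" if "i \<in> I" for i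
    using sum_groupD(1)[OF G x that] .
  have fin: "finite ?F"
    by (rule sum_groupD(2)[OF G x])
  obtain k where k: "\<And>i. i \<in> I \<Longrightarrow> k i > 0" "\<And>i. i \<in> I \<Longrightarrow> x i \<in> torsion (k i) (G i)"
    using tor[OF _ mem] by metis
  \<comment> \<open>Exponents killing the single components, multiplied over the finite
    support.\<close>
  let ?n = "\<Prod>i\<in>?F. k i"
  have "x i \<in> torsion ?n (G i)" if i: "i \<in> I" for i
  proof (cases "i \<in> ?F")
    case True
    then obtain m where "?n = k i * m"
      using dvd_prodI[OF fin True, of k] by (auto simp: dvd_def)
    then show ?thesis
      using k(2)[OF i] G[OF i]
      by (simp add: torsion_def monoid.nat_pow_pow[symmetric] monoid.nat_pow_one group.is_monoid)
  next
    case False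
    then show ?thesis
      using i one_in_torsion[OF G[OF i]] by simp
  qed
  then have "x \<in> torsion ?n (sum_group I G)"
    using x by (auto simp: torsion_sum_group[OF G] carrier_sum_group[OF G] PiE_iff)
  moreover have "?n > 0"
    by (intro prod_pos) (simp add: k(1))
  ultimately show ?thesis
    by blast
qed

lemma pruefer_group_torsion:
  assumes "prime p" "z \<in> carrier (pruefer_group p)"
  shows "\<exists>n>0. z \<in> torsion n (pruefer_group p)"
proof -
  obtain k where "z ^ p ^ k = 1"
    using assms(2) by (auto simp: pruefer_group_def)
  then show ?thesis
    unfolding torsion_pruefer_group using prime_gt_0_nat[OF assms(1)] by (intro exI[of _ "p ^ k"]) auto
qed

section \<open>The classification\<close>

lemma divisible_group_iso:
  assumes "f \<in> iso G H" "group G" "group H" "divisible_group G"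
  shows "divisible_group H"
  unfolding divisible_group_def
proof (intro ballI allI impI)
  interpret group_hom G H f
    using assms by (simp add: iso_def group_hom_def group_hom_axioms_def)
  fix x and n :: nat
  assume "x \<in> carrier H" "n > 0"
  then have "x \<in> f ` carrier G"
    using assms(1) by (simp add: iso_def bij_betw_def)
  then obtain y where y: "y \<in> carrier G" "f y = x"
    by auto
  then obtain z where "z \<in> carrier G" "z [^]\<^bsub>G\<^esub> n = y"
    using assms(4) \<open>n > 0\<close> unfolding divisible_group_def by blast
  with y show "\<exists>y\<in>carrier H. y [^]\<^bsub>H\<^esub> n = x"
    using hom_nat_pow[of z n] by (intro bexI[of _ "f z"]) simp_all
qed

text \<open>Only the summand at \<open>p\<close> has \<open>p\<close>-torsion, and each of its
  copies contributes a factor \<open>p\<close>. Thus the finite cardinal at \<open>p\<close> can be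
  read off from the group.\<close>

lemma card_torsion_standard_divisible_group:
  assumes p: "prime p" and Kp: "finite (K p)"
  shows "card (torsion p (direct_power K0 rat_group
      \<times>\<times> sum_group {p. prime p} (\<lambda>p. direct_power (K p) (pruefer_group p)))) = p ^ card (K p)"
proof -
  have "card (torsion p (sum_group {p. prime p} (\<lambda>p. direct_power (K p) (pruefer_group p)))) =
      card (torsion p (direct_power (K p) (pruefer_group p)))"
  proof (rule card_torsion_sum_group_single)
    fix q assume "q \<in> {p. prime p}" "q \<noteq> p"
    then show "torsion p (direct_power (K q) (pruefer_group q)) = {\<one>\<^bsub>direct_power (K q) (pruefer_group q)\<^esub>}"
      using p by (intro torsion_sum_group_trivial) (auto intro: group_pruefer_group dest: torsion_pruefer_group_other_prime)
  qed (use p in \<open>auto simp: group_pruefer_group\<close>)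
  also have "\<dots> = p ^ card (K p)"
    using p Kp by (simp add: card_torsion_sum_group_finite group_pruefer_group
        card_torsion_pruefer_group prime_gt_0_nat)
  finally show ?thesis
    using p by (simp add: torsion_DirProd card_cartesian_product torsion_sum_group_trivial
        group_rat_group torsion_rat_group prime_gt_0_nat)
qed

text \<open>A divisor of \<open>p ^ k\<close> is itself a power of \<open>p\<close>, so the
  exponents can be compared.\<close>

lemma even_if_prime_power_square:
  assumes "prime (p :: nat)" "p ^ k = c ^ 2"
  shows "even k"
proof -
  have "c dvd p ^ k"
    using assms(2) by simp
  then obtain i where "c = p ^ i"
    using divides_primepow_nat[OF assms(1)] by blast
  then have "p ^ k = p ^ (i * 2)"
    using assms(2) by (simp add: power_mult)
  then show ?thesis
    using prime_gt_1_nat[OF assms(1)] by simp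
qed

text \<open>Modulo 4 the square of \<open>p\<close> is 1, so every odd power of \<open>p\<close> is
  again 3.\<close>

lemma even_if_four_dvd_power_minus_one:
  assumes "p mod 4 = (3::nat)" "4 dvd p ^ k - 1"
  shows "even k"
proof (rule ccontr)
  assume "odd k"
  then obtain m where k: "k = 2 * m + 1"
    using oddE by blast
  have "p ^ 2 mod 4 = 1"
    using power_mod[of p 4 2] assms(1) by simp
  then have "(p ^ 2) ^ m mod 4 = 1"
    using power_mod[of "p ^ 2" 4 m] by simp
  then have "(p ^ 2) ^ m * p mod 4 = 3"
    using assms(1) mod_mult_eq[of "(p ^ 2) ^ m" 4 p] by simp
  then have "p ^ k mod 4 = 3"
    unfolding k power_add power_mult by simp
  moreover have "\<not> 4 dvd n - 1" if "n mod 4 = 3" for n :: nat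
    using that by presburger
  ultimately show False
    using assms(2) by blast
qed

theorem theorem4p4:
  fixes G :: "('a, 'm) monoid_scheme"
    and K0 :: "'i set"
    and K :: "nat \<Rightarrow> 'j set"
  assumes "comm_group G"
    and "divisible_group G"
    and "G \<cong> direct_power K0 rat_group
             \<times>\<times> sum_group {p::nat. prime p} (\<lambda>p. direct_power (K p) (pruefer_group p))"
  shows "(\<exists>J. inverse_ambiguous_automorphism G J) \<longleftrightarrow>
           \<not> finite_odd K0 \<and>
           \<not> finite_odd (K 2) \<and>
           (\<forall>p::nat. prime p \<and> p mod 4 = 3 \<longrightarrow> \<not> finite_odd (K p))"
proof -
  let ?A = "direct_power K0 rat_group"
  let ?P = "\<lambda>p. direct_power (K p) (pruefer_group p)"
  let ?S = "sum_group {p::nat. prime p} ?P"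
  let ?H = "?A \<times>\<times> ?S"
  interpret G: comm_group G by fact
  have P: "group (?P p)" if "prime p" for p
    using that by (simp add: group_pruefer_group)
  have A: "group ?A"
    by (simp add: group_rat_group)
  have S: "group ?S"
    by (rule sum_group) (simp add: P)
  have grH: "group ?H"
    using A S by (rule DirProd_group)
  interpret H: comm_group ?H
    using assms(3) grH by (intro G.iso_imp_comm_group group.is_monoid)
  obtain f where f: "f \<in> iso G ?H"
    using assms(3) by (auto simp: is_iso_def)
  have divH: "divisible_group ?H"
    using f G.is_group grH assms(2) by (rule divisible_group_iso)
  have "?H \<cong> G"
    using assms(3) G.iso_sym by blast
  then have iff: "(\<exists>J. inverse_ambiguous_automorphism G J) \<longleftrightarrow> (\<exists>J. squares_to_inv ?H J)"
    unfolding G.inverse_ambiguous_automorphism_iff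
    using squares_to_inv_iso[OF G.is_group grH assms(3)] squares_to_inv_iso[OF grH G.is_group] by blast
  show ?thesis
    unfolding iff
  proof
    assume "\<exists>J. squares_to_inv ?H J"
    then obtain J where J: "squares_to_inv ?H J" ..
    have "\<not> finite_odd K0"
    proof
      assume K0: "finite_odd K0"
      \<comment> \<open>The first factor is torsion-free and the second is torsion, so
        \<open>J\<close> induces a map on the rational factor alone.\<close>
      have tf: "torsion n ?A = {\<one>\<^bsub>?A\<^esub>}" if "n > 0" for n
        using that by (intro torsion_sum_group_trivial group_rat_group torsion_rat_group)
      have "\<exists>n>0. s \<in> torsion n ?S" if "s \<in> carrier ?S" for s
        using _ _ that
      proof (rule sum_group_of_torsion_groups)
        fix p x assume p: "p \<in> {p. prime p}" and x: "x \<in> carrier (?P p)"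
        show "\<exists>n>0. x \<in> torsion n (?P p)"
          by (rule sum_group_of_torsion_groups[OF _ _ x])
            (use p in \<open>auto intro: group_pruefer_group pruefer_group_torsion\<close>)
      qed (use P in auto)
      then show False
        using even_card_if_squares_to_inv_rat[OF _ squares_to_inv_torsion_free_part[OF A S J tf]] K0
        by (auto simp: finite_odd_def)
    qed
    moreover have "\<not> finite_odd (K 2)"
    proof
      assume K2: "finite_odd (K 2)"
      obtain c where "card (torsion 2 ?H) = c ^ 2"
        using H.card_two_torsion_square[OF J divH] by blast
      moreover have "card (torsion 2 ?H) = 2 ^ card (K 2)"
        using K2 unfolding finite_odd_def
        by (intro card_torsion_standard_divisible_group two_is_prime_nat) blast
      ultimately have "2 ^ card (K 2) = c ^ 2"
        by (rule trans[OF sym, rotated])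
      then have "even (card (K 2))"
        by (rule even_if_prime_power_square[OF two_is_prime_nat])
      with K2 show False
        by (simp add: finite_odd_def)
    qed
    moreover have "\<not> finite_odd (K p)" if p: "prime p" "p mod 4 = 3" for p
    proof
      assume Kp: "finite_odd (K p)"
      then have card: "card (torsion p ?H) = p ^ card (K p)"
        using p(1) unfolding finite_odd_def
        by (intro card_torsion_standard_divisible_group) blast+
      \<comment> \<open>Positivity yields finiteness, as \<open>card\<close> of an infinite set is
        0.\<close>
      have "card (torsion p ?H) > 0"
        unfolding card using p by (simp add: prime_gt_0_nat)
      then have fin: "finite (torsion p ?H)"
        by (rule card_ge_0_finite)
      have "odd p"
        using p(2) by presburger
      then have "4 dvd card (torsion p ?H) - 1"
        using fin by (rule H.four_dvd_card_torsion[OF J])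
      then have "4 dvd p ^ card (K p) - 1"
        by (simp only: card)
      then have "even (card (K p))"
        by (rule even_if_four_dvd_power_minus_one[OF p(2)])
      with Kp show False
        by (simp add: finite_odd_def)
    qed
    ultimately show "\<not> finite_odd K0 \<and> \<not> finite_odd (K 2) \<and>
        (\<forall>p. prime p \<and> p mod 4 = 3 \<longrightarrow> \<not> finite_odd (K p))"
      by blast
  next
    assume R: "\<not> finite_odd K0 \<and> \<not> finite_odd (K 2) \<and>
        (\<forall>p. prime p \<and> p mod 4 = 3 \<longrightarrow> \<not> finite_odd (K p))"
    have PJ: "\<exists>J. squares_to_inv (?P p) J" if p: "prime p" for p
    proof (cases "p mod 4 = 1")
      \<comment> \<open>Here each copy of the Pruefer group carries its own automorphism, whatever
        the number of copies.\<close>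
      case True
      then show ?thesis
        using p by (intro squares_to_inv_sum_group squares_to_inv_pruefer_group group_pruefer_group)
    next
      case False
      have "p = 2 \<or> p mod 4 = 3"
      proof (cases "p = 2")
        case False
        then have "p > 2"
          using prime_ge_2_nat[OF p] by linarith
        then have "odd p"
          by (rule prime_odd_nat[OF p])
        then show ?thesis
          using \<open>p mod 4 \<noteq> 1\<close> by presburger
      qed simp
      then have "\<not> finite_odd (K p)"
        using R p by blast
      then show ?thesis
        using comm_group_pruefer_group[OF prime_gt_0_nat[OF p]] by (intro squares_to_inv_direct_power)
    qed
    have "\<exists>J. squares_to_inv ?S J"
      by (rule squares_to_inv_sum_group) (simp_all add: P PJ)
    moreover have "\<exists>J. squares_to_inv ?A J"
      using R comm_group_rat_group by (intro squares_to_inv_direct_power) auto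
    ultimately show "\<exists>J. squares_to_inv ?H J"
      using squares_to_inv_DirProd[OF A S] by blast
  qed
qed

end
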